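(* As $k\to\infty$, the occupancy measure $M^N(k)$ converges almost surely, for the weak topology on $\mathcal{P}[0,1]$, to a random probability measure $M^N(\infty)$, which is a partial consensus with $L^N$ components, where $L^N := \mathrm{Card}(\mathcal{C}^N(K^N))$ is the final number of clusters.
   Context: Model. Fix an integer $N\ge 2$, a deviation threshold $\Delta\in(0,1]$ and a confidence factor $w\in(0,1)$. The discrete-time process $X^N(k)=(X^N_i(k))_{1\le i\le N}\in[0,1]^N$, $k\in\mathbb{N}=\{0,1,\dots\}$, evolves from an arbitrary initial state $X^N(0)$ as follows. At each instant $k$, two distinct peers $i,j\in\{1,\dots,N\}$ are selected uniformly at random without replacement, independently of the past. If $|X^N_i(k)-X^N_j(k)|>\Delta$ then $X^N(k+1)=X^N(k)$. If $|X^N_i(k)-X^N_j(k)|\le\Delta$ then $X^N_i(k+1)=wX^N_i(k)+(1-w)X^N_j(k)$, $X^N_j(k+1)=wX^N_j(k)+(1-w)X^N_i(k)$, and all other coordinates are unchanged. The occupancy measure is $M^N(k)=\frac1N\sum_{i=1}^N\delta_{X^N_i(k)}$. $\mathcal{P}[0,1]$ is the space of Borel probability measures on $[0,1]$. Partial consensus. $\nu\in\mathcal{P}[0,1]$ is a partial consensus with $c$ components if $\nu=\sum_{m=1}^c\alpha_m\delta_{x_m}$ with $x_m\in[0,1]$, $|x_m-x_{m'}|>\Delta$ for $m\ne m'$, and $\alpha_m>0$ (necessarily $\sum_m\alpha_m=1$). Clusters. Two peers $i,j$ are connected at time $k$ if $|X^N_i(k)-X^N_j(k)|\le\Delta$.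 A cluster at time $k$ is a connected component of the graph on $\{1,\dots,N\}$ defined by this relation. $\mathcal{C}^N(k)$ is the set of clusters at time $k$ (a random partition of $\{1,\dots,N\}$). $K^N$ is a random time, almost surely finite, such that $\mathcal{C}^N(k)=\mathcal{C}^N(K^N)$ for all $k\ge K^N$ (e.g. the smallest such time). *)

theory Defs
  imports "HOL-Probability.Probability" "HOL-Library.Extended_Nat"
begin

definition peer_pairs :: "nat \<Rightarrow> (nat \<times> nat) set" where
  "peer_pairs N = {(i, j). i \<in> {1..N} \<and> j \<in> {1..N} \<and> i \<noteq> j}"

definition interact :: "real \<Rightarrow> real \<Rightarrow> nat \<times> nat \<Rightarrow> (nat \<Rightarrow> real) \<Rightarrow> nat \<Rightarrow> real" where
  "interact \<Delta> w = (\<lambda>(i, j) x.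
     if \<bar>x i - x j\<bar> > \<Delta> then x
     else x(i := w * x i + (1 - w) * x j, j := w * x j + (1 - w) * x i))"

text \<open>
  \<^term>\<open>X k \<omega> i\<close> is the state of peer \<^term>\<open>i\<close> at time \<^term>\<open>k\<close>; only the peers in
  \<^term>\<open>{1..N}\<close> matter. The pair selected at time \<^term>\<open>k\<close> is ordered and uniform among the
  pairs of distinct peers; the update is symmetric in the pair. The past of time \<^term>\<open>k\<close> is
  generated by the initial state, which may itself be random, and the selections before
  \<^term>\<open>k\<close>: they determine the states up to time \<^term>\<open>k\<close>.
\<close>

locale bounded_confidence = prob_space M
  for M :: "'w measure" +
  fixes N :: nat and \<Delta> w :: real
    and sel :: "nat \<Rightarrow> 'w \<Rightarrow> nat \<times> nat"
    and X :: "nat \<Rightarrow> 'w \<Rightarrow> nat \<Rightarrow> real"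
  assumes N: "N \<ge> 2"
    and \<Delta>: "0 < \<Delta>" "\<Delta> \<le> 1"
    and w: "0 < w" "w < 1"
    and initial_measurable: "\<And>i. i \<in> {1..N} \<Longrightarrow> (\<lambda>\<omega>. X 0 \<omega> i) \<in> borel_measurable M"
    and initial_range: "\<And>i \<omega>. i \<in> {1..N} \<Longrightarrow> \<omega> \<in> space M \<Longrightarrow> X 0 \<omega> i \<in> {0..1}"
    and sel_measurable: "\<And>k. sel k \<in> M \<rightarrow>\<^sub>M count_space (peer_pairs N)"
    and sel_uniform:
      "\<And>k. distr M (count_space (peer_pairs N)) (sel k) = uniform_count_measure (peer_pairs N)"
    and sel_indep_past:
      "\<And>k. indep_set
         (sets (vimage_algebra (space M) (sel k) (count_space (peer_pairs N))))
         (sets (vimage_algebra (space M)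
            (\<lambda>\<omega>. (\<lambda>i\<in>{1..N}. X 0 \<omega> i, \<lambda>l\<in>{..<k}. sel l \<omega>))
            ((\<Pi>\<^sub>M i\<in>{1..N}. (borel :: real measure)) \<Otimes>\<^sub>M
             (\<Pi>\<^sub>M l\<in>{..<k}. count_space (peer_pairs N)))))"
    and step: "\<And>k i \<omega>. i \<in> {1..N} \<Longrightarrow> \<omega> \<in> space M \<Longrightarrow>
      X (Suc k) \<omega> i = interact \<Delta> w (sel k \<omega>) (X k \<omega>) i"

abbreviation borel01 :: "real measure" where
  "borel01 \<equiv> restrict_space borel {0..1}"

text \<open>
  The Borel probability measures on [0,1] are the points of \<^term>\<open>prob_algebra borel01\<close>, so a
  random probability measure is a measurable map into \<^term>\<open>prob_algebra borel01\<close>.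
\<close>

definition weak_topology01 :: "real measure topology" where
  "weak_topology01 = topology_generated_by
     {{\<mu> \<in> space (prob_algebra borel01). (\<integral>x. f x \<partial>\<mu>) \<in> U} | f U.
        continuous_on {0..1} f \<and> open (U :: real set)}"

lemma topspace_weak_topology01: "topspace weak_topology01 = space (prob_algebra borel01)"
proof -
  have "space (prob_algebra borel01) =
      {\<mu> \<in> space (prob_algebra borel01). (\<integral>x. 0 \<partial>\<mu>) \<in> (UNIV :: real set)}"
    by simp
  then have "space (prob_algebra borel01) \<in>
      {{\<mu> \<in> space (prob_algebra borel01). (\<integral>x. f x \<partial>\<mu>) \<in> U} | f U.
        continuous_on {0..1} f \<and> open (U :: real set)}"
    using continuous_on_const open_UNIV by blast
  then show ?thesis
    unfolding weak_topology01_def topology_generated_by_topspace by blast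
qed

lemma limitin_weak_topology01:
  "limitin weak_topology01 \<mu> \<nu> F \<longleftrightarrow>
     \<nu> \<in> space (prob_algebra borel01) \<and>
     (\<forall>\<^sub>F n in F. \<mu> n \<in> space (prob_algebra borel01)) \<and>
     (\<forall>f :: real \<Rightarrow> real. continuous_on {0..1} f \<longrightarrow>
        ((\<lambda>n. \<integral>x. f x \<partial>\<mu> n) \<longlongrightarrow> (\<integral>x. f x \<partial>\<nu>)) F)"
    (is "?L \<longleftrightarrow> ?R")
proof
  assume L: ?L
  have \<nu>: "\<nu> \<in> space (prob_algebra borel01)"
    using limitin_topspace[OF L] by (simp add: topspace_weak_topology01)
  have "\<forall>\<^sub>F n in F. \<mu> n \<in> topspace weak_topology01"
    using L unfolding limitin_def by blast
  moreover have "((\<lambda>n. \<integral>x. f x \<partial>\<mu> n) \<longlongrightarrow> (\<integral>x. f x \<partial>\<nu>)) F"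
    if f: "continuous_on {0..1} f" for f :: "real \<Rightarrow> real"
  proof (rule topological_tendstoI)
    fix U :: "real set"
    assume U: "open U" "(\<integral>x. f x \<partial>\<nu>) \<in> U"
    let ?V = "{\<mu> \<in> space (prob_algebra borel01). (\<integral>x. f x \<partial>\<mu>) \<in> U}"
    have "openin weak_topology01 ?V"
      unfolding weak_topology01_def by (rule topology_generated_by_Basis) (use f U in blast)
    moreover have "\<nu> \<in> ?V"
      using \<nu> U(2) by simp
    ultimately have "\<forall>\<^sub>F n in F. \<mu> n \<in> ?V"
      by (rule L[unfolded limitin_def, THEN conjunct2, rule_format, OF conjI])
    then show "\<forall>\<^sub>F n in F. (\<integral>x. f x \<partial>\<mu> n) \<in> U"
      by (rule eventually_mono) simp
  qed
  ultimately show ?R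
    using \<nu> by (simp add: topspace_weak_topology01)
next
  assume R: ?R
  define S where "S = {{\<mu> \<in> space (prob_algebra borel01). (\<integral>x. f x \<partial>\<mu>) \<in> U} | f U.
        continuous_on {0..1} f \<and> open (U :: real set)}"
  have ev: "\<nu> \<in> V \<Longrightarrow> \<forall>\<^sub>F n in F. \<mu> n \<in> V" if "generate_topology_on S V" for V
    using that
  proof (induction rule: generate_topology_on.induct)
    case Empty
    then show ?case by simp
  next
    case (Int a b)
    then show ?case by (simp add: eventually_conj_iff)
  next
    case (UN K)
    then obtain k where "k \<in> K" "\<nu> \<in> k" by blast
    then have "\<forall>\<^sub>F n in F. \<mu> n \<in> k" using UN.IH by blast
    then show ?case by (rule eventually_mono) (use \<open>k \<in> K\<close> in blast)
  next
    case (Basis s)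
    then obtain f :: "real \<Rightarrow> real" and U where f: "continuous_on {0..1} f" and U: "open U"
      and s: "s = {\<mu> \<in> space (prob_algebra borel01). (\<integral>x. f x \<partial>\<mu>) \<in> U}"
      unfolding S_def by blast
    have "(\<integral>x. f x \<partial>\<nu>) \<in> U" using Basis.prems s by simp
    then have "\<forall>\<^sub>F n in F. (\<integral>x. f x \<partial>\<mu> n) \<in> U"
      using R f U by (intro topological_tendstoD) auto
    moreover have "\<forall>\<^sub>F n in F. \<mu> n \<in> space (prob_algebra borel01)" using R by blast
    ultimately show ?case
      unfolding s by eventually_elim simp
  qed
  have "\<forall>\<^sub>F n in F. \<mu> n \<in> V" if "openin weak_topology01 V" "\<nu> \<in> V" for V
    using that ev[of V]
    by (simp add: weak_topology01_def openin_topology_generated_by_iff flip: S_def)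
  then show ?L
    using R by (simp add: limitin_def topspace_weak_topology01)
qed

definition dirac_sum :: "nat set \<Rightarrow> (nat \<Rightarrow> real) \<Rightarrow> (nat \<Rightarrow> real) \<Rightarrow> real measure" where
  "dirac_sum I \<alpha> x = measure_of {0..1} (sets borel01)
     (\<lambda>A. \<Sum>m\<in>I. ennreal (\<alpha> m) * emeasure (return borel01 (x m)) A)"

lemma space_dirac_sum: "space (dirac_sum I \<alpha> x) = {0..1}"
  and sets_dirac_sum: "sets (dirac_sum I \<alpha> x) = sets borel01"
proof -
  have "sigma_algebra {0..1} (sets borel01)"
    using sets.sigma_algebra_axioms[of borel01] by (simp add: space_restrict_space)
  then show "space (dirac_sum I \<alpha> x) = {0..1}" "sets (dirac_sum I \<alpha> x) = sets borel01"
    unfolding dirac_sum_def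
    by (simp_all add: space_measure_of_conv sigma_algebra.sets_measure_of_eq)
qed

lemma emeasure_dirac_sum:
  assumes "A \<in> sets borel01"
  shows "emeasure (dirac_sum I \<alpha> x) A =
    (\<Sum>m\<in>I. ennreal (\<alpha> m) * emeasure (return borel01 (x m)) A)"
proof (rule emeasure_measure_of[OF dirac_sum_def])
  show "sets borel01 \<subseteq> Pow {0..1}"
    using sets.space_closed[of borel01] by (simp add: space_restrict_space)
  show "A \<in> sets (dirac_sum I \<alpha> x)"
    using assms by (simp add: sets_dirac_sum)
  show "positive (sets (dirac_sum I \<alpha> x))
      (\<lambda>A. \<Sum>m\<in>I. ennreal (\<alpha> m) * emeasure (return borel01 (x m)) A)"
    by (simp add: positive_def)
  show "countably_additive (sets (dirac_sum I \<alpha> x))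
      (\<lambda>A. \<Sum>m\<in>I. ennreal (\<alpha> m) * emeasure (return borel01 (x m)) A)"
  proof (rule countably_additiveI)
    fix B :: "nat \<Rightarrow> real set"
    assume "range B \<subseteq> sets (dirac_sum I \<alpha> x)" "disjoint_family B"
    then have "(\<Sum>n. emeasure (return borel01 (x m)) (B n)) =
        emeasure (return borel01 (x m)) (\<Union>n. B n)" for m
      by (intro suminf_emeasure) (auto simp: sets_dirac_sum)
    then show "(\<Sum>n. \<Sum>m\<in>I. ennreal (\<alpha> m) * emeasure (return borel01 (x m)) (B n)) =
        (\<Sum>m\<in>I. ennreal (\<alpha> m) * emeasure (return borel01 (x m)) (\<Union>n. B n))"
      by (subst suminf_sum) simp_all
  qed
qed

definition occupancy :: "nat \<Rightarrow> (nat \<Rightarrow> real) \<Rightarrow> real measure" where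
  "occupancy N x = dirac_sum {1..N} (\<lambda>_. 1 / real N) x"

definition partial_consensus :: "real \<Rightarrow> nat \<Rightarrow> real measure \<Rightarrow> bool" where
  "partial_consensus \<Delta> c \<nu> \<longleftrightarrow>
     \<nu> \<in> space (prob_algebra borel01) \<and>
     (\<exists>\<alpha> x. \<nu> = dirac_sum {1..c} \<alpha> x \<and>
        (\<forall>m\<in>{1..c}. x m \<in> {0..1} \<and> \<alpha> m > 0) \<and>
        (\<forall>m\<in>{1..c}. \<forall>m'\<in>{1..c}. m \<noteq> m' \<longrightarrow> \<bar>x m - x m'\<bar> > \<Delta>))"

definition connected_peers :: "nat \<Rightarrow> real \<Rightarrow> (nat \<Rightarrow> real) \<Rightarrow> (nat \<times> nat) set" where
  "connected_peers N \<Delta> x = {(i, j). i \<in> {1..N} \<and> j \<in> {1..N} \<and> \<bar>x i - x j\<bar> \<le> \<Delta>}"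

definition clusters :: "nat \<Rightarrow> real \<Rightarrow> (nat \<Rightarrow> real) \<Rightarrow> nat set set" where
  "clusters N \<Delta> x = {1..N} // (connected_peers N \<Delta> x)\<^sup>*"

definition cluster_freezing_time ::
  "'w measure \<Rightarrow> nat \<Rightarrow> real \<Rightarrow> (nat \<Rightarrow> 'w \<Rightarrow> nat \<Rightarrow> real) \<Rightarrow> ('w \<Rightarrow> enat) \<Rightarrow> bool" where
  "cluster_freezing_time M N \<Delta> X K \<longleftrightarrow>
     K \<in> M \<rightarrow>\<^sub>M count_space UNIV \<and>
     (AE \<omega> in M. K \<omega> < \<infinity> \<and>
        (\<forall>k. K \<omega> \<le> enat k \<longrightarrow>
           clusters N \<Delta> (X k \<omega>) = clusters N \<Delta> (X (the_enat (K \<omega>)) \<omega>)))"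

definition final_cluster_count ::
  "nat \<Rightarrow> real \<Rightarrow> (nat \<Rightarrow> 'w \<Rightarrow> nat \<Rightarrow> real) \<Rightarrow> ('w \<Rightarrow> enat) \<Rightarrow> 'w \<Rightarrow> nat" where
  "final_cluster_count N \<Delta> X K \<omega> = card (clusters N \<Delta> (X (the_enat (K \<omega>)) \<omega>))"

end

theory Submission
  imports Defs
begin

text \<open>
  An interaction of two peers at distance \<open>d \<le> \<Delta>\<close> keeps the sum of their states and lowers the sum
  of squares of all states by exactly \<open>2 w (1 - w) d\<^sup>2\<close> (\<open>energy_interact\<close>). The sum of squares
  lies between \<open>0\<close> and \<open>N\<close>, so the total of all these losses is bounded along every trajectory.
  The pair selected at time \<open>k\<close> is uniform and independent of the state at time \<open>k\<close>; the expected
  loss due to a given pair is therefore a fixed multiple of the expected squared distance of this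
  pair, counted as zero beyond \<open>\<Delta>\<close>. These expectations are summable over \<open>k\<close>, hence almost surely
  the truncated squared distance of \<^emph>\<open>every\<close> pair, selected or not, tends to zero
  (\<open>AE_gaps_vanish\<close>). This is the only place where randomness enters.

  The rest holds along each trajectory with this property. Eventually two peers are either closer
  than \<open>\<Delta> / 3\<close> or farther apart than \<open>\<Delta>\<close>. Connectedness is then an equivalence relation, and since
  one interaction moves a peer by at most \<open>\<Delta> / 3\<close>, no pair can cross from one regime to the other:
  the relation, and with it the set of clusters, is frozen (\<open>connected_peers_settled\<close>). From then on
  each cluster keeps its mean while its diameter tends to zero, so its peers converge to that mean
  (\<open>converges\<close>).

  Passing to the limit in the distances between clusters would only give separation by at least
  \<open>\<Delta>\<close>. The strict inequality comes from the means: at the time of freezing the states of two clusters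
  lie in two sets separated by a gap larger than \<open>\<Delta>\<close>, hence so are their means, and these are
  already the limit points (\<open>limit_state_separated\<close>).
\<close>

section \<open>Deterministic dynamics along one selection sequence\<close>

text \<open>
  The cut-off at \<open>\<Delta>\<close> makes this the squared distance that an interaction of the pair would act on:
  it vanishes exactly when the interaction changes nothing.
\<close>

definition gap_sq :: "real \<Rightarrow> nat \<times> nat \<Rightarrow> (nat \<Rightarrow> real) \<Rightarrow> real" where
  "gap_sq \<Delta> = (\<lambda>(i, j) x. if \<bar>x i - x j\<bar> \<le> \<Delta> then (x i - x j)\<^sup>2 else 0)"

definition energy :: "nat \<Rightarrow> (nat \<Rightarrow> real) \<Rightarrow> real" where
  "energy N x = (\<Sum>i\<in>{1..N}. (x i)\<^sup>2)"

lemma finite_peer_pairs: "finite (peer_pairs N)"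
  by (rule finite_subset[of _ "{1..N} \<times> {1..N}"]) (auto simp: peer_pairs_def)

lemma gap_sq_nonneg: "gap_sq \<Delta> q x \<ge> 0"
  by (auto simp: gap_sq_def split: prod.splits)

lemma sum_fun_upd2:
  fixes g :: "'b \<Rightarrow> real"
  assumes "finite A" "i \<in> A" "j \<in> A" "i \<noteq> j"
  shows "(\<Sum>l\<in>A. g ((x(i := a, j := b)) l)) = (\<Sum>l\<in>A. g (x l)) - g (x i) - g (x j) + g a + g b"
proof -
  have split: "(\<Sum>l\<in>A. h l) = h i + (h j + (\<Sum>l\<in>A - {i} - {j}. h l))" for h :: "_ \<Rightarrow> real"
    using assms by (simp add: sum.remove[of A i] sum.remove[of "A - {i}" j])
  have rest: "(\<Sum>l\<in>A - {i} - {j}. g ((x(i := a, j := b)) l)) = (\<Sum>l\<in>A - {i} - {j}. g (x l))"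
    by (intro sum.cong) auto
  show ?thesis
    unfolding split[of "\<lambda>l. g ((x(i := a, j := b)) l)"] split[of "\<lambda>l. g (x l)"] rest
    using assms(4) by simp
qed

lemma interact_range:
  assumes "0 < w" "w < 1" "q \<in> peer_pairs N" "\<And>i. i \<in> {1..N} \<Longrightarrow> x i \<in> {0..1}" "i \<in> {1..N}"
  shows "interact \<Delta> w q x i \<in> {0..1}"
proof -
  have convex: "w * a + (1 - w) * b \<in> {0..1}" if "a \<in> {0..1}" "b \<in> {0..1}" for a b :: real
    using convexD_alt[OF convex_real_interval(5) that(2,1), of w] assms(1,2) by (simp add: algebra_simps)
  show ?thesis
    using assms(3-5) convex by (auto simp: interact_def peer_pairs_def split: prod.splits)
qed

text \<open>
  The parallelogram-type identity
  \<open>a\<^sup>2 + b\<^sup>2 - (w a + (1 - w) b)\<^sup>2 - (w b + (1 - w) a)\<^sup>2 = 2 w (1 - w) (a - b)\<^sup>2\<close>.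
\<close>

lemma energy_interact:
  assumes "q \<in> peer_pairs N"
  shows "energy N x - energy N (interact \<Delta> w q x) = 2 * w * (1 - w) * gap_sq \<Delta> q x"
proof (cases q)
  case (Pair i j)
  then have ij: "i \<in> {1..N}" "j \<in> {1..N}" "i \<noteq> j"
    using assms by (auto simp: peer_pairs_def)
  show ?thesis
  proof (cases "\<bar>x i - x j\<bar> \<le> \<Delta>")
    case True
    then have "interact \<Delta> w q x = x(i := w * x i + (1 - w) * x j, j := w * x j + (1 - w) * x i)"
      using Pair by (simp add: interact_def)
    then have "energy N (interact \<Delta> w q x) = energy N x - (x i)\<^sup>2 - (x j)\<^sup>2
        + (w * x i + (1 - w) * x j)\<^sup>2 + (w * x j + (1 - w) * x i)\<^sup>2"
      using sum_fun_upd2[OF _ ij, of "\<lambda>t. t\<^sup>2"] by (simp add: energy_def)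
    then show ?thesis
      using Pair True by (simp add: gap_sq_def power2_eq_square algebra_simps)
  qed (use Pair in \<open>simp add: interact_def gap_sq_def\<close>)
qed

text \<open>
  An interaction preserves the sum over its two peers, so a set of peers keeps its total as long as
  no interaction crosses its boundary. Conservation of cluster means rests on this.
\<close>

lemma sum_interact:
  assumes "q \<in> peer_pairs N" "finite A" "\<bar>x (fst q) - x (snd q)\<bar> \<le> \<Delta> \<Longrightarrow> fst q \<in> A \<longleftrightarrow> snd q \<in> A"
  shows "(\<Sum>l\<in>A. interact \<Delta> w q x l) = (\<Sum>l\<in>A. x l)"
proof (cases q)
  case (Pair i j)
  have neq: "i \<noteq> j"
    using assms Pair by (auto simp: peer_pairs_def)
  let ?x' = "x(i := w * x i + (1 - w) * x j, j := w * x j + (1 - w) * x i)"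
  show ?thesis
  proof (cases "\<bar>x i - x j\<bar> \<le> \<Delta>")
    case True
    then have upd: "interact \<Delta> w q x = ?x'"
      using Pair by (simp add: interact_def)
    consider "i \<in> A" "j \<in> A" | "i \<notin> A" "j \<notin> A"
      using assms(3) True Pair by auto
    then show ?thesis
    proof cases
      case 1
      then show ?thesis
        unfolding upd sum_fun_upd2[OF assms(2) 1 neq, of "\<lambda>t. t"] by (simp add: algebra_simps)
    next
      case 2
      then show ?thesis
        unfolding upd by (intro sum.cong) auto
    qed
  qed (use Pair in \<open>simp add: interact_def\<close>)
qed

lemma interact_displacement:
  assumes "0 < w" "w < 1" "gap_sq \<Delta> q x \<le> \<epsilon>\<^sup>2" "0 \<le> \<epsilon>" "q \<in> peer_pairs N"
  shows "\<bar>interact \<Delta> w q x l - x l\<bar> \<le> \<epsilon>"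
proof (cases q)
  case (Pair i j)
  have bound: "\<bar>(1 - w) * t\<bar> \<le> \<epsilon>" if "\<bar>t\<bar> \<le> \<epsilon>" for t
  proof -
    have "\<bar>(1 - w) * t\<bar> \<le> 1 * \<bar>t\<bar>"
      unfolding abs_mult using assms(1,2) by (intro mult_right_mono) auto
    then show ?thesis using that by simp
  qed
  show ?thesis
  proof (cases "\<bar>x i - x j\<bar> \<le> \<Delta>")
    case True
    then have le: "\<bar>x i - x j\<bar> \<le> \<epsilon>"
      using assms(3,4) Pair abs_le_square_iff[of "x i - x j" \<epsilon>] by (simp add: gap_sq_def)
    have "w * x i + (1 - w) * x j - x i = (1 - w) * (x j - x i)"
      "w * x j + (1 - w) * x i - x j = (1 - w) * (x i - x j)"
      by (simp_all add: algebra_simps)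
    then have "\<bar>w * x i + (1 - w) * x j - x i\<bar> \<le> \<epsilon>" "\<bar>w * x j + (1 - w) * x i - x j\<bar> \<le> \<epsilon>"
      using bound[of "x j - x i"] bound[of "x i - x j"] le by (simp_all add: abs_minus_commute)
    then show ?thesis
      using True Pair assms(4) by (simp add: interact_def)
  qed (use Pair assms(4) in \<open>simp add: interact_def\<close>)
qed

text \<open>
  A single trajectory with an arbitrary selection sequence. The assumption \<open>gaps_vanish\<close> holds
  almost surely in the random model and carries all that the deterministic argument needs from it.
\<close>

locale confidence_path =
  fixes N :: nat and \<Delta> w :: real and s :: "nat \<Rightarrow> nat \<times> nat" and x :: "nat \<Rightarrow> nat \<Rightarrow> real"
  assumes \<Delta>_pos: "0 < \<Delta>" and w_pos: "0 < w" and w_less: "w < 1"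
    and pair: "\<And>k. s k \<in> peer_pairs N"
    and path_step: "\<And>k i. i \<in> {1..N} \<Longrightarrow> x (Suc k) i = interact \<Delta> w (s k) (x k) i"
    and gaps_vanish: "\<And>q. q \<in> peer_pairs N \<Longrightarrow> (\<lambda>k. gap_sq \<Delta> q (x k)) \<longlonglongrightarrow> 0"
begin

lemma eventually_gap_dichotomy:
  assumes "0 < \<epsilon>"
  shows "\<forall>\<^sub>F k in sequentially. \<forall>i\<in>{1..N}. \<forall>j\<in>{1..N}.
    \<bar>x k i - x k j\<bar> \<le> \<Delta> \<longrightarrow> \<bar>x k i - x k j\<bar> < \<epsilon>"
proof -
  have "\<forall>\<^sub>F k in sequentially. \<forall>q\<in>peer_pairs N. gap_sq \<Delta> q (x k) < \<epsilon>\<^sup>2"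
    using assms
    by (intro eventually_ball_finite finite_peer_pairs ballI order_tendstoD(2)[OF gaps_vanish]) simp_all
  then show ?thesis
  proof eventually_elim
    case (elim k)
    show ?case
    proof (intro ballI impI)
      fix i j assume ij: "i \<in> {1..N}" "j \<in> {1..N}" "\<bar>x k i - x k j\<bar> \<le> \<Delta>"
      show "\<bar>x k i - x k j\<bar> < \<epsilon>"
      proof (cases "i = j")
        case False
        then have "(x k i - x k j)\<^sup>2 < \<epsilon>\<^sup>2"
          using elim[rule_format, of "(i, j)"] ij by (simp add: peer_pairs_def gap_sq_def)
        then show ?thesis
          using assms power_less_imp_less_base[of "\<bar>x k i - x k j\<bar>" 2 \<epsilon>] by simp
      qed (use assms in simp)
    qed
  qed
qed

definition tight :: "nat \<Rightarrow> bool" where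
  "tight k \<longleftrightarrow> (\<forall>i\<in>{1..N}. \<forall>j\<in>{1..N}. \<bar>x k i - x k j\<bar> \<le> \<Delta> \<longrightarrow> \<bar>x k i - x k j\<bar> < \<Delta> / 3)"

text \<open>
  A pair at distance below \<open>\<Delta> / 3\<close> is at distance below \<open>\<Delta>\<close> one step later, because each of its
  peers moves by at most \<open>\<Delta> / 3\<close>. The converse is the same argument backwards in time, which is why
  tightness is assumed at both times.
\<close>

lemma connected_peers_Suc:
  assumes "tight k" "tight (Suc k)"
  shows "connected_peers N \<Delta> (x (Suc k)) = connected_peers N \<Delta> (x k)"
proof -
  have gap: "gap_sq \<Delta> (s k) (x k) \<le> (\<Delta> / 3)\<^sup>2"
  proof (cases "s k")
    case (Pair i j)
    then have ij: "i \<in> {1..N}" "j \<in> {1..N}"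
      using pair[of k] by (auto simp: peer_pairs_def)
    have "(x k i - x k j)\<^sup>2 \<le> (\<Delta> / 3)\<^sup>2" if "\<bar>x k i - x k j\<bar> \<le> \<Delta>"
    proof -
      have "\<bar>x k i - x k j\<bar> < \<Delta> / 3"
        using assms(1) that ij unfolding tight_def by blast
      then show ?thesis
        using \<Delta>_pos abs_le_square_iff[of "x k i - x k j" "\<Delta> / 3"] by simp
    qed
    then show ?thesis
      using Pair by (simp add: gap_sq_def)
  qed
  have move: "\<bar>x (Suc k) i - x k i\<bar> \<le> \<Delta> / 3" if "i \<in> {1..N}" for i
    using interact_displacement[OF w_pos w_less gap _ pair] path_step[OF that] \<Delta>_pos by simp
  have "\<bar>x (Suc k) i - x (Suc k) j\<bar> \<le> \<Delta> \<longleftrightarrow> \<bar>x k i - x k j\<bar> \<le> \<Delta>"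
    if ij: "i \<in> {1..N}" "j \<in> {1..N}" for i j
  proof
    assume "\<bar>x (Suc k) i - x (Suc k) j\<bar> \<le> \<Delta>"
    then have "\<bar>x (Suc k) i - x (Suc k) j\<bar> < \<Delta> / 3"
      using assms(2) ij unfolding tight_def by blast
    then show "\<bar>x k i - x k j\<bar> \<le> \<Delta>"
      using move[OF ij(1)] move[OF ij(2)] by linarith
  next
    assume "\<bar>x k i - x k j\<bar> \<le> \<Delta>"
    then have "\<bar>x k i - x k j\<bar> < \<Delta> / 3"
      using assms(1) ij unfolding tight_def by blast
    then show "\<bar>x (Suc k) i - x (Suc k) j\<bar> \<le> \<Delta>"
      using move[OF ij(1)] move[OF ij(2)] by linarith
  qed
  then show ?thesis
    by (auto simp: connected_peers_def)
qed

lemma tight_equiv: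
  assumes "tight k"
  shows "equiv {1..N} (connected_peers N \<Delta> (x k))"
proof (rule equivI)
  show "trans (connected_peers N \<Delta> (x k))"
  proof (rule transI)
    fix a b c
    assume "(a, b) \<in> connected_peers N \<Delta> (x k)" "(b, c) \<in> connected_peers N \<Delta> (x k)"
    then have "a \<in> {1..N}" "c \<in> {1..N}" "\<bar>x k a - x k b\<bar> < \<Delta> / 3" "\<bar>x k b - x k c\<bar> < \<Delta> / 3"
      using assms unfolding tight_def connected_peers_def by blast+
    moreover from this have "\<bar>x k a - x k c\<bar> \<le> \<Delta>"
      using \<Delta>_pos by linarith
    ultimately show "(a, c) \<in> connected_peers N \<Delta> (x k)"
      by (simp add: connected_peers_def)
  qed
qed (use \<Delta>_pos in \<open>auto simp: connected_peers_def refl_on_def sym_def abs_minus_commute\<close>)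

definition settling_time :: nat where
  "settling_time = (SOME K. \<forall>k\<ge>K. tight k)"

definition final_rel :: "(nat \<times> nat) set" where
  "final_rel = connected_peers N \<Delta> (x settling_time)"

text \<open>The cluster mean, which is the same at all later times.\<close>

definition limit_state :: "nat \<Rightarrow> real" where
  "limit_state i = (\<Sum>j\<in>final_rel `` {i}. x settling_time j) / card (final_rel `` {i})"

lemma tight_settled: "settling_time \<le> k \<Longrightarrow> tight k"
proof -
  have "\<exists>K. \<forall>k\<ge>K. tight k"
    using eventually_gap_dichotomy[of "\<Delta> / 3"] \<Delta>_pos
    by (simp add: tight_def eventually_sequentially)
  then have "\<forall>k\<ge>settling_time. tight k"
    unfolding settling_time_def by (rule someI_ex)
  then show "settling_time \<le> k \<Longrightarrow> tight k" by blast
qed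

lemma connected_peers_settled:
  assumes "settling_time \<le> k"
  shows "connected_peers N \<Delta> (x k) = final_rel"
  using assms
proof (induction k rule: dec_induct)
  case (step k)
  then show ?case
    using connected_peers_Suc[of k] tight_settled[of k] tight_settled[of "Suc k"] by simp
qed (simp add: final_rel_def)

lemma equiv_final_rel: "equiv {1..N} final_rel"
  unfolding final_rel_def by (intro tight_equiv tight_settled) simp

lemma final_class:
  assumes "i \<in> {1..N}"
  shows "finite (final_rel `` {i})" "final_rel `` {i} \<subseteq> {1..N}" "0 < card (final_rel `` {i})"
proof -
  show sub: "final_rel `` {i} \<subseteq> {1..N}"
    by (auto simp: final_rel_def connected_peers_def)
  then show fin: "finite (final_rel `` {i})"
    by (rule finite_subset) simp
  show "0 < card (final_rel `` {i})"
    using equiv_class_self[OF equiv_final_rel assms] fin by (auto simp: card_gt_0_iff)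
qed

lemma class_sum_settled:
  assumes "settling_time \<le> k" "i \<in> {1..N}"
  shows "(\<Sum>j\<in>final_rel `` {i}. x k j) = (\<Sum>j\<in>final_rel `` {i}. x settling_time j)"
  using assms(1)
proof (induction k rule: dec_induct)
  case (step k)
  obtain a b where ab: "s k = (a, b)" by fastforce
  have "a \<in> final_rel `` {i} \<longleftrightarrow> b \<in> final_rel `` {i}" if "\<bar>x k a - x k b\<bar> \<le> \<Delta>"
  proof -
    have "(a, b) \<in> final_rel"
      using that pair[of k] ab connected_peers_settled[OF step(1)]
      by (auto simp: connected_peers_def peer_pairs_def)
    then show ?thesis
      using equiv_final_rel by (auto simp: equiv_def dest: symD transD)
  qed
  then have "(\<Sum>j\<in>final_rel `` {i}. interact \<Delta> w (s k) (x k) j) = (\<Sum>j\<in>final_rel `` {i}. x k j)"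
    using ab by (intro sum_interact[OF pair] final_class assms) auto
  moreover have "(\<Sum>j\<in>final_rel `` {i}. x (Suc k) j)
      = (\<Sum>j\<in>final_rel `` {i}. interact \<Delta> w (s k) (x k) j)"
    using final_class(2)[OF assms(2)] by (intro sum.cong path_step) auto
  ultimately show ?case
    using step.IH by simp
qed simp

text \<open>
  After settling, \<open>x k i\<close> differs from the constant mean of its class by the average of
  \<open>x k i - x k j\<close> over the class, and each of these differences tends to zero.
\<close>

lemma converges:
  assumes "i \<in> {1..N}"
  shows "(\<lambda>k. x k i) \<longlonglongrightarrow> limit_state i"
proof -
  let ?C = "final_rel `` {i}"
  have diff: "(\<lambda>k. x k i - x k j) \<longlonglongrightarrow> 0" if "j \<in> ?C" for j
  proof (rule tendstoI)
    fix \<epsilon> :: real assume "0 < \<epsilon>"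
    have "\<forall>\<^sub>F k in sequentially. (i, j) \<in> connected_peers N \<Delta> (x k)"
      using connected_peers_settled that by (auto simp: eventually_sequentially)
    then show "\<forall>\<^sub>F k in sequentially. dist (x k i - x k j) 0 < \<epsilon>"
      using eventually_gap_dichotomy[OF \<open>0 < \<epsilon>\<close>]
      by eventually_elim (auto simp: connected_peers_def)
  qed
  have "(\<lambda>k. limit_state i + (\<Sum>j\<in>?C. x k i - x k j) / card ?C) \<longlonglongrightarrow> limit_state i + (\<Sum>j\<in>?C. 0) / card ?C"
    using final_class(3)[OF assms] by (intro tendsto_intros diff) auto
  moreover have "\<forall>\<^sub>F k in sequentially. limit_state i + (\<Sum>j\<in>?C. x k i - x k j) / card ?C = x k i"
  proof (rule eventually_sequentiallyI)
    fix k assume "settling_time \<le> k"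
    then show "limit_state i + (\<Sum>j\<in>?C. x k i - x k j) / card ?C = x k i"
      using class_sum_settled[OF _ assms, of k] final_class(3)[OF assms]
      by (simp add: limit_state_def sum_subtractf diff_divide_distrib)
  qed
  ultimately show ?thesis
    by (auto elim: Lim_transform_eventually)
qed

lemma limit_state_same_class:
  assumes "(i, j) \<in> final_rel"
  shows "limit_state i = limit_state j"
  using equiv_class_eq[OF equiv_final_rel assms] by (simp add: limit_state_def)

text \<open>
  At the settling time all states of one class lie on the same side of all states of the other: the
  classes have diameter less than \<open>\<Delta> / 3\<close> and any two of their members are more than \<open>\<Delta>\<close> apart. A
  strict inequality between all members passes to the means, because the classes are finite.
\<close>

lemma limit_state_separated:
  assumes "i \<in> {1..N}" "j \<in> {1..N}" "(i, j) \<notin> final_rel"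
  shows "\<bar>limit_state i - limit_state j\<bar> > \<Delta>"
proof -
  let ?y = "x settling_time"
  have near: "\<bar>?y a - ?y b\<bar> < \<Delta> / 3" if "(a, b) \<in> final_rel" for a b
    using that tight_settled[of settling_time] by (auto simp: final_rel_def connected_peers_def tight_def)
  have far: "\<bar>?y a - ?y b\<bar> > \<Delta>" if "(i, a) \<in> final_rel" "(j, b) \<in> final_rel" for a b
  proof -
    have "(a, b) \<notin> final_rel"
      using assms(3) that equiv_final_rel unfolding equiv_def by (meson symD transD)
    then show ?thesis
      using that by (auto simp: final_rel_def connected_peers_def)
  qed
  \<comment> \<open>Stated for fresh names because it is applied in both orders of \<open>i\<close> and \<open>j\<close>.\<close>
  have sep: "limit_state a' > limit_state b' + \<Delta>"
    if ab: "a' \<in> {1..N}" "b' \<in> {1..N}" and *: "\<And>a b. (a', a) \<in> final_rel \<Longrightarrow> (b', b) \<in> final_rel \<Longrightarrow> ?y a > ?y b + \<Delta>"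
    for a' b'
  proof -
    let ?A = "final_rel `` {a'}" and ?B = "final_rel `` {b'}"
    have above: "limit_state a' > t" if "\<And>a. a \<in> ?A \<Longrightarrow> ?y a > t" for t
    proof -
      have "(\<Sum>a\<in>?A. t) < (\<Sum>a\<in>?A. ?y a)"
        using final_class[OF ab(1)] that by (intro sum_strict_mono) auto
      then show ?thesis
        using final_class(3)[OF ab(1)] by (simp add: limit_state_def field_simps)
    qed
    have below: "limit_state b' < t" if "\<And>b. b \<in> ?B \<Longrightarrow> ?y b < t" for t
    proof -
      have "(\<Sum>b\<in>?B. ?y b) < (\<Sum>b\<in>?B. t)"
        using final_class[OF ab(2)] that by (intro sum_strict_mono) auto
      then show ?thesis
        using final_class(3)[OF ab(2)] by (simp add: limit_state_def field_simps)
    qed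
    have "limit_state b' < ?y a - \<Delta>" if "a \<in> ?A" for a
      using below[of "?y a - \<Delta>"] * that by force
    then show ?thesis
      using above[of "limit_state b' + \<Delta>"] by force
  qed
  have self: "(i, i) \<in> final_rel" "(j, j) \<in> final_rel"
    using equiv_final_rel assms by (auto simp: equiv_def refl_on_def)
  show ?thesis
  proof (cases "?y i > ?y j")
    case True
    have "limit_state i > limit_state j + \<Delta>"
    proof (rule sep[OF assms(1,2)])
      fix a b assume "(i, a) \<in> final_rel" "(j, b) \<in> final_rel"
      then show "?y a > ?y b + \<Delta>"
        using far[OF self] far[of a b] near[of i a] near[of j b] True by linarith
    qed
    then show ?thesis by linarith
  next
    case False
    have "limit_state j > limit_state i + \<Delta>"
    proof (rule sep[OF assms(2,1)])
      fix b a assume "(j, b) \<in> final_rel" "(i, a) \<in> final_rel"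
      then show "?y b > ?y a + \<Delta>"
        using far[OF self] far[of a b] near[of i a] near[of j b] False by linarith
    qed
    then show ?thesis by linarith
  qed
qed

text \<open>
  The classes of the reflexive transitive closure are those of \<open>final_rel\<close>, since the latter is
  already an equivalence relation on the peers.
\<close>

lemma clusters_settled:
  assumes "settling_time \<le> k"
  shows "clusters N \<Delta> (x k) = {1..N} // final_rel"
proof -
  have "final_rel\<^sup>* `` {i} = final_rel `` {i}" if "i \<in> {1..N}" for i
    using equiv_final_rel equiv_class_self[OF equiv_final_rel that]
    by (auto simp: equiv_def trancl_id rtrancl_eq_or_trancl)
  then show ?thesis
    unfolding clusters_def connected_peers_settled[OF assms] quotient_def by simp
qed

end

section \<open>Occupancy measures\<close>

lemma emeasure_return_borel01:
  "A \<in> sets borel01 \<Longrightarrow> emeasure (return borel01 a) A = indicator A a"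
  by (rule emeasure_return)

text \<open>
  Seeing the occupancy measure as an image of the uniform distribution on the peers reduces total
  mass one and the integrals of test functions to finite averages over the peers.
\<close>

lemma occupancy_eq_distr:
  assumes "N > 0" "\<And>i. i \<in> {1..N} \<Longrightarrow> x i \<in> {0..1}"
  shows "occupancy N x = distr (uniform_count_measure {1..N}) borel01 x"
proof (rule measure_eqI)
  show "sets (occupancy N x) = sets (distr (uniform_count_measure {1..N}) borel01 x)"
    by (simp add: occupancy_def sets_dirac_sum)
  fix A assume "A \<in> sets (occupancy N x)"
  then have A: "A \<in> sets borel01" by (simp add: occupancy_def sets_dirac_sum)
  have meas: "x \<in> uniform_count_measure {1..N} \<rightarrow>\<^sub>M borel01"
    using assms(2) by (simp add: measurable_def space_uniform_count_measure
        sets_uniform_count_measure space_restrict_space)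
  have "emeasure (occupancy N x) A = (\<Sum>i\<in>{1..N}. ennreal (1 / real N) * ennreal (indicator A (x i)))"
    using A by (simp add: occupancy_def emeasure_dirac_sum ennreal_indicator)
  also have "\<dots> = ennreal (\<Sum>i\<in>{1..N}. 1 / real N * indicator A (x i))"
    by (simp add: ennreal_mult'[symmetric])
  also have "(\<Sum>i\<in>{1..N}. 1 / real N * indicator A (x i)) = card (x -` A \<inter> {1..N}) / real N"
  proof -
    have "(\<Sum>i\<in>{1..N}. indicator A (x i)) = (\<Sum>i\<in>{1..N}. indicator (x -` A) i :: real)"
      by (intro sum.cong) (auto simp: indicator_def)
    also have "\<dots> = card (x -` A \<inter> {1..N})"
      by (simp add: indicator_def sum_of_bool_eq Int_def conj_commute vimage_def)
    finally show ?thesis by (simp add: sum_divide_distrib[symmetric])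
  qed
  also have "ennreal \<dots> = emeasure (distr (uniform_count_measure {1..N}) borel01 x) A"
    using meas A by (simp add: emeasure_distr space_uniform_count_measure emeasure_uniform_count_measure)
  finally show "emeasure (occupancy N x) A = emeasure (distr (uniform_count_measure {1..N}) borel01 x) A" .
qed

lemma occupancy_prob_algebra:
  assumes "N > 0" "\<And>i. i \<in> {1..N} \<Longrightarrow> x i \<in> {0..1}"
  shows "occupancy N x \<in> space (prob_algebra borel01)"
proof -
  have "prob_space (uniform_count_measure {1..N})"
    using assms(1) by (intro prob_space_uniform_count_measure) auto
  then have "prob_space (distr (uniform_count_measure {1..N}) borel01 x)"
    using assms(2) by (intro prob_space.prob_space_distr) (auto simp: measurable_def
        space_uniform_count_measure sets_uniform_count_measure space_restrict_space)
  moreover have "occupancy N x = distr (uniform_count_measure {1..N}) borel01 x"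
    using assms by (rule occupancy_eq_distr)
  ultimately show ?thesis
    by (simp add: space_prob_algebra)
qed

lemma integral_occupancy:
  assumes "N > 0" "\<And>i. i \<in> {1..N} \<Longrightarrow> x i \<in> {0..1}" "continuous_on {0..1} f"
  shows "(\<integral>t. f t \<partial>occupancy N x) = (\<Sum>i\<in>{1..N}. f (x i) / real N :: real)"
proof -
  have "occupancy N x = distr (uniform_count_measure {1..N}) borel01 x"
    using assms(1,2) by (rule occupancy_eq_distr)
  moreover have "(\<integral>t. f t \<partial>distr (uniform_count_measure {1..N}) borel01 x)
      = (\<integral>i. f (x i) \<partial>uniform_count_measure {1..N})"
    using assms(2) borel_measurable_continuous_on_restrict[OF assms(3)]
    by (intro integral_distr) (auto simp: measurable_def
        space_uniform_count_measure sets_uniform_count_measure space_restrict_space)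
  ultimately show ?thesis
    by (simp add: integral_uniform_count_measure sum_divide_distrib)
qed

lemma limitin_occupancy:
  assumes "N > 0" "\<And>k i. i \<in> {1..N} \<Longrightarrow> x k i \<in> {0..1}"
    and lim: "\<And>i. i \<in> {1..N} \<Longrightarrow> (\<lambda>k. x k i) \<longlonglongrightarrow> l i"
  shows "limitin weak_topology01 (\<lambda>k. occupancy N (x k)) (occupancy N l) sequentially"
proof -
  have l: "l i \<in> {0..1}" if "i \<in> {1..N}" for i
    by (rule closed_sequentially[OF closed_atLeastAtMost _ lim[OF that]]) (use assms(2) that in blast)
  have "(\<lambda>k. \<integral>t. f t \<partial>occupancy N (x k)) \<longlonglongrightarrow> (\<integral>t. f t \<partial>occupancy N l)"
    if f: "continuous_on {0..1} f" for f :: "real \<Rightarrow> real"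
  proof -
    have "(\<lambda>k. f (x k i)) \<longlonglongrightarrow> f (l i)" if "i \<in> {1..N}" for i
      using l assms(2) that by (intro continuous_on_tendsto_compose[OF f lim]) auto
    then have "(\<lambda>k. \<Sum>i\<in>{1..N}. f (x k i) / real N) \<longlonglongrightarrow> (\<Sum>i\<in>{1..N}. f (l i) / real N)"
      using assms(1) by (intro tendsto_intros) auto
    moreover have "(\<integral>t. f t \<partial>occupancy N (x k)) = (\<Sum>i\<in>{1..N}. f (x k i) / real N)" for k
      using assms(1,2) f by (rule integral_occupancy)
    moreover have "(\<integral>t. f t \<partial>occupancy N l) = (\<Sum>i\<in>{1..N}. f (l i) / real N)"
      using assms(1) l f by (rule integral_occupancy)
    ultimately show ?thesis by simp
  qed
  moreover have "occupancy N (x k) \<in> space (prob_algebra borel01)" for k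
    using assms(1,2) by (rule occupancy_prob_algebra)
  moreover have "occupancy N l \<in> space (prob_algebra borel01)"
    using assms(1) l by (rule occupancy_prob_algebra)
  ultimately show ?thesis
    by (simp add: limitin_weak_topology01)
qed

lemma measurable_occupancy:
  assumes "N > 0" "\<And>i. i \<in> {1..N} \<Longrightarrow> (\<lambda>\<omega>. L \<omega> i) \<in> borel_measurable M"
    and "\<And>\<omega> i. \<omega> \<in> space M \<Longrightarrow> i \<in> {1..N} \<Longrightarrow> L \<omega> i \<in> {0..1}"
  shows "(\<lambda>\<omega>. occupancy N (L \<omega>)) \<in> M \<rightarrow>\<^sub>M prob_algebra borel01"
proof (rule measurable_prob_algebraI)
  have prob: "prob_space (occupancy N (L \<omega>))" if "\<omega> \<in> space M" for \<omega>
    using occupancy_prob_algebra[of N "L \<omega>"] assms that by (simp add: space_prob_algebra)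
  then show "\<omega> \<in> space M \<Longrightarrow> prob_space (occupancy N (L \<omega>))" for \<omega> .
  show "(\<lambda>\<omega>. occupancy N (L \<omega>)) \<in> M \<rightarrow>\<^sub>M subprob_algebra borel01"
  proof (rule measurable_subprob_algebra)
    fix A assume A: "A \<in> sets borel01"
    have L: "(\<lambda>\<omega>. L \<omega> i) \<in> M \<rightarrow>\<^sub>M borel01" if "i \<in> {1..N}" for i
      using assms that by (intro measurable_restrict_space2) auto
    have "(\<lambda>\<omega>. emeasure (return borel01 (L \<omega> i)) A) \<in> borel_measurable M" if "i \<in> {1..N}" for i
      using measurable_compose[OF L[OF that] borel_measurable_indicator[OF A]]
      by (simp add: emeasure_return_borel01[OF A])
    then show "(\<lambda>\<omega>. emeasure (occupancy N (L \<omega>)) A) \<in> borel_measurable M"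
      unfolding occupancy_def emeasure_dirac_sum[OF A]
      by (intro borel_measurable_sum borel_measurable_times_ennreal measurable_const) auto
  qed (use prob in \<open>auto simp: prob_space_imp_subprob_space occupancy_def sets_dirac_sum\<close>)
qed

text \<open>
  Atoms at equal positions are merged: the class of a peer becomes one atom whose weight is the
  proportion of peers in that class, and the classes are numbered by an arbitrary bijection.
\<close>

lemma partial_consensus_occupancy:
  assumes "N > 0" "\<And>i. i \<in> {1..N} \<Longrightarrow> l i \<in> {0..1}"
    and R: "equiv {1..N} R"
    and same: "\<And>i j. (i, j) \<in> R \<Longrightarrow> l i = l j"
    and sep: "\<And>i j. i \<in> {1..N} \<Longrightarrow> j \<in> {1..N} \<Longrightarrow> (i, j) \<notin> R \<Longrightarrow> \<bar>l i - l j\<bar> > \<Delta>"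
  shows "partial_consensus \<Delta> (card ({1..N} // R)) (occupancy N l)"
proof -
  let ?Q = "{1..N} // R"
  have R_sub: "R \<subseteq> {1..N} \<times> {1..N}"
    using R by (rule equiv_type)
  have fin: "finite ?Q"
    by (rule finite_quotient[OF _ R_sub]) simp
  then obtain h where h: "bij_betw h {1..card ?Q} ?Q"
    using ex_bij_betw_nat_finite_1 by blast
  have hQ: "h m \<in> ?Q" if "m \<in> {1..card ?Q}" for m
    using h that by (auto simp: bij_betw_def)
  have cls: "C \<subseteq> {1..N}" "finite C" "C \<noteq> {}" if "C \<in> ?Q" for C
  proof -
    show "C \<subseteq> {1..N}" using that Union_quotient[OF R] by auto
    then show "finite C" by (rule finite_subset) simp
    show "C \<noteq> {}" using in_quotient_imp_non_empty[OF R that] .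
  qed
  define r where "r m = (SOME i. i \<in> h m)" for m
  have r: "r m \<in> h m" if "m \<in> {1..card ?Q}" for m
    unfolding r_def using cls(3)[OF hQ[OF that]] by (simp add: some_in_eq)
  have r_N: "r m \<in> {1..N}" if "m \<in> {1..card ?Q}" for m
    using r[OF that] cls(1)[OF hQ[OF that]] by blast
  have const: "l i = l (r m)" if "m \<in> {1..card ?Q}" "i \<in> h m" for m i
    using same quotient_eq_iff[OF R hQ[OF that(1)] hQ[OF that(1)] that(2) r[OF that(1)]] by simp
  have apart: "\<bar>l (r m) - l (r m')\<bar> > \<Delta>"
    if m: "m \<in> {1..card ?Q}" "m' \<in> {1..card ?Q}" "m \<noteq> m'" for m m'
  proof (rule sep)
    have "h m \<noteq> h m'"
      using inj_on_eq_iff[OF bij_betw_imp_inj_on[OF h] m(1,2)] m(3) by simp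
    then show "(r m, r m') \<notin> R"
      using quotient_eq_iff[OF R hQ[OF m(1)] hQ[OF m(2)] r[OF m(1)] r[OF m(2)]] by simp
  qed (rule r_N[OF m(1)] r_N[OF m(2)])+
  have "(\<Sum>i\<in>{1..N}. ennreal (1 / real N) * g (l i)) =
      (\<Sum>m\<in>{1..card ?Q}. ennreal (card (h m) / real N) * g (l (r m)))" for g :: "real \<Rightarrow> ennreal"
  proof -
    have "(\<Sum>i\<in>{1..N}. ennreal (1 / real N) * g (l i)) = (\<Sum>i\<in>\<Union>?Q. ennreal (1 / real N) * g (l i))"
      by (simp only: Union_quotient[OF R])
    also have "\<dots> = (\<Sum>C\<in>?Q. \<Sum>i\<in>C. ennreal (1 / real N) * g (l i))"
    proof -
      have "sum f (\<Union>?Q) = (sum \<circ> sum) f ?Q" for f :: "nat \<Rightarrow> ennreal"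
        by (rule sum.Union_disjoint) (use cls(2) quotient_disj[OF R] in blast)+
      then show ?thesis by simp
    qed
    also have "\<dots> = (\<Sum>m\<in>{1..card ?Q}. \<Sum>i\<in>h m. ennreal (1 / real N) * g (l i))"
      by (rule sum.reindex_bij_betw[OF h, symmetric])
    also have "\<dots> = (\<Sum>m\<in>{1..card ?Q}. ennreal (card (h m) / real N) * g (l (r m)))"
    proof (rule sum.cong[OF refl])
      fix m assume m: "m \<in> {1..card ?Q}"
      have "(\<Sum>i\<in>h m. ennreal (1 / real N) * g (l i)) = (\<Sum>i\<in>h m. ennreal (1 / real N)) * g (l (r m))"
        using const[OF m] by (simp add: mult.assoc)
      also have "(\<Sum>i\<in>h m. ennreal (1 / real N)) = ennreal (card (h m) / real N)"
        by (subst sum_ennreal) auto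
      finally show "(\<Sum>i\<in>h m. ennreal (1 / real N) * g (l i)) = ennreal (card (h m) / real N) * g (l (r m))" .
    qed
    finally show ?thesis .
  qed
  then have "occupancy N l = dirac_sum {1..card ?Q} (\<lambda>m. card (h m) / real N) (\<lambda>m. l (r m))"
    unfolding occupancy_def dirac_sum_def by (intro arg_cong2[where f="measure_of {0..1}"] ext refl)
  moreover have "card (h m) / real N > 0" if "m \<in> {1..card ?Q}" for m
    using cls[OF hQ[OF that]] assms(1) by (simp add: card_gt_0_iff)
  moreover have "l (r m) \<in> {0..1}" if "m \<in> {1..card ?Q}" for m
    using assms(2)[OF r_N[OF that]] .
  ultimately show ?thesis
    using apart occupancy_prob_algebra[of N l] assms(1,2) unfolding partial_consensus_def by blast
qed

section \<open>Almost sure vanishing of the gaps\<close>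

context bounded_confidence
begin

text \<open>The information available before the selection at time \<open>k\<close> is made.\<close>

definition past :: "nat \<Rightarrow> 'w measure" where
  "past k = vimage_algebra (space M)
     (\<lambda>\<omega>. (\<lambda>i\<in>{1..N}. X 0 \<omega> i, \<lambda>l\<in>{..<k}. sel l \<omega>))
     ((\<Pi>\<^sub>M i\<in>{1..N}. (borel :: real measure)) \<Otimes>\<^sub>M (\<Pi>\<^sub>M l\<in>{..<k}. count_space (peer_pairs N)))"

lemma space_past [simp]: "space (past k) = space M"
  by (simp add: past_def)

lemma sel_in_pairs: "\<omega> \<in> space M \<Longrightarrow> sel k \<omega> \<in> peer_pairs N"
  using measurable_space[OF sel_measurable] by simp

lemma history_measurable:
  "(\<lambda>\<omega>. (\<lambda>i\<in>{1..N}. X 0 \<omega> i, \<lambda>l\<in>{..<k}. sel l \<omega>)) \<in> past k \<rightarrow>\<^sub>M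
     (\<Pi>\<^sub>M i\<in>{1..N}. (borel :: real measure)) \<Otimes>\<^sub>M (\<Pi>\<^sub>M l\<in>{..<k}. count_space (peer_pairs N))"
  unfolding past_def
  by (rule measurable_vimage_algebra1) (auto simp: space_pair_measure space_PiM sel_in_pairs)

lemma initial_measurable_past:
  assumes "i \<in> {1..N}"
  shows "(\<lambda>\<omega>. X 0 \<omega> i) \<in> borel_measurable (past k)"
  using measurable_compose[OF measurable_compose[OF history_measurable[of k] measurable_fst]
      measurable_component_singleton[OF assms]] assms
  by simp

lemma sel_measurable_past:
  assumes "l < k"
  shows "sel l \<in> past k \<rightarrow>\<^sub>M count_space (peer_pairs N)"
  using measurable_compose[OF measurable_compose[OF history_measurable[of k] measurable_snd]
      measurable_component_singleton[of l "{..<k}"]] assms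
  by simp

lemma measurable_interact:
  assumes "q \<in> peer_pairs N" "i \<in> {1..N}"
    and x: "\<And>i. i \<in> {1..N} \<Longrightarrow> (\<lambda>\<omega>. x \<omega> i) \<in> borel_measurable F"
  shows "(\<lambda>\<omega>. interact \<Delta> w q (x \<omega>) i) \<in> borel_measurable F"
proof (cases q)
  case (Pair a b)
  then have ab: "a \<in> {1..N}" "b \<in> {1..N}"
    using assms(1) by (auto simp: peer_pairs_def)
  note [measurable] = x[OF ab(1)] x[OF ab(2)] x[OF assms(2)]
  have "(\<lambda>\<omega>. interact \<Delta> w q (x \<omega>) i) = (\<lambda>\<omega>. if \<bar>x \<omega> a - x \<omega> b\<bar> > \<Delta> then x \<omega> i
      else if i = b then w * x \<omega> b + (1 - w) * x \<omega> a
      else if i = a then w * x \<omega> a + (1 - w) * x \<omega> b else x \<omega> i)"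
    using Pair by (auto simp: interact_def fun_eq_iff)
  then show ?thesis by simp
qed

text \<open>
  The states up to time \<open>n\<close> are determined by the initial state and the selections before \<open>n\<close>; this
  is what turns independence of the past into independence of the current state.
\<close>

lemma state_measurable_past:
  assumes "k \<le> n" "i \<in> {1..N}"
  shows "(\<lambda>\<omega>. X k \<omega> i) \<in> borel_measurable (past n)"
  using assms
proof (induction k arbitrary: i)
  case 0
  then show ?case by (simp only: initial_measurable_past)
next
  case (Suc k)
  have "(\<lambda>\<omega>. interact \<Delta> w (sel k \<omega>) (X k \<omega>) i) \<in> borel_measurable (past n)"
  proof (rule measurable_compose_countable'[where I="peer_pairs N" and g="sel k"])
    show "(\<lambda>\<omega>. interact \<Delta> w q (X k \<omega>) i) \<in> borel_measurable (past n)" if "q \<in> peer_pairs N" for q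
      using Suc that by (intro measurable_interact) auto
  qed (use Suc.prems in \<open>auto intro: sel_measurable_past countable_finite finite_peer_pairs\<close>)
  then show ?case
    by (rule measurable_cong[THEN iffD1, rotated]) (use step Suc.prems in simp)
qed

lemma sets_past_le: "sets (past k) \<subseteq> sets M"
  using sel_indep_past[of k] by (simp add: past_def indep_set_def indep_sets_def UNIV_bool)

lemma state_measurable:
  assumes "i \<in> {1..N}"
  shows "(\<lambda>\<omega>. X k \<omega> i) \<in> borel_measurable M"
  using state_measurable_past[OF order.refl assms, of k] sets_past_le[of k]
  by (auto simp: measurable_def)

lemma state_range:
  assumes "i \<in> {1..N}" "\<omega> \<in> space M"
  shows "X k \<omega> i \<in> {0..1}"
  using assms(1)
proof (induction k arbitrary: i)
  case 0
  then show ?case using initial_range assms(2) by blast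
next
  case (Suc k)
  then show ?case
    using interact_range[OF w sel_in_pairs[OF assms(2)]] step[OF _ assms(2)] by metis
qed

lemma gap_sq_measurable:
  assumes "q \<in> peer_pairs N" "\<And>i. i \<in> {1..N} \<Longrightarrow> (\<lambda>\<omega>. x \<omega> i) \<in> borel_measurable F"
  shows "(\<lambda>\<omega>. gap_sq \<Delta> q (x \<omega>)) \<in> borel_measurable F"
proof (cases q)
  case (Pair i j)
  then have [measurable]: "(\<lambda>\<omega>. x \<omega> i) \<in> borel_measurable F" "(\<lambda>\<omega>. x \<omega> j) \<in> borel_measurable F"
    using assms by (auto simp: peer_pairs_def)
  show ?thesis
    unfolding Pair gap_sq_def prod.case by measurable
qed

lemma gap_sq_le_1:
  assumes "q \<in> peer_pairs N" "\<omega> \<in> space M"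
  shows "gap_sq \<Delta> q (X k \<omega>) \<le> 1"
proof -
  have "(X k \<omega> i - X k \<omega> j)\<^sup>2 \<le> 1" if "i \<in> {1..N}" "j \<in> {1..N}" for i j
    using state_range[OF that(1) assms(2), of k] state_range[OF that(2) assms(2), of k]
    by (auto simp: abs_square_le_1 abs_le_iff)
  then show ?thesis
    using assms by (auto simp: gap_sq_def peer_pairs_def)
qed

lemma gap_sq_integrable:
  assumes "q \<in> peer_pairs N"
  shows "integrable M (\<lambda>\<omega>. gap_sq \<Delta> q (X k \<omega>))"
  using gap_sq_le_1[OF assms] gap_sq_nonneg
  by (intro integrable_const_bound[where B=1] gap_sq_measurable[OF assms] state_measurable AE_I2) auto

lemma prob_sel:
  assumes "q \<in> peer_pairs N"
  shows "prob (sel k -` {q} \<inter> space M) = 1 / card (peer_pairs N)"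
proof -
  have "measure (distr M (count_space (peer_pairs N)) (sel k)) {q} = 1 / card (peer_pairs N)"
    unfolding sel_uniform using assms by (simp add: measure_uniform_count_measure finite_peer_pairs)
  then show ?thesis
    using assms by (simp add: measure_distr[OF sel_measurable])
qed

text \<open>
  Independence of the selection and the current state gives the expected contribution of \<open>q\<close> as the
  product of the selection probability and the expected truncated squared distance. This lets a
  bound on selected interactions control all pairs at all times.
\<close>

lemma expectation_selected_gap:
  assumes "q \<in> peer_pairs N"
  shows "integrable M (\<lambda>\<omega>. indicator {q} (sel k \<omega>) * gap_sq \<Delta> q (X k \<omega>))"
    and "expectation (\<lambda>\<omega>. indicator {q} (sel k \<omega>) * gap_sq \<Delta> q (X k \<omega>))
      = expectation (\<lambda>\<omega>. gap_sq \<Delta> q (X k \<omega>)) / card (peer_pairs N)"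
proof -
  let ?U = "\<lambda>\<omega>. indicator {q} (sel k \<omega>) :: real" and ?V = "\<lambda>\<omega>. gap_sq \<Delta> q (X k \<omega>)"
  let ?sel = "vimage_algebra (space M) (sel k) (count_space (peer_pairs N))"
  have sel_meas: "sel k \<in> ?sel \<rightarrow>\<^sub>M count_space (peer_pairs N)"
    by (rule measurable_vimage_algebra1) (use sel_in_pairs in auto)
  have U_sel: "?U \<in> borel_measurable ?sel"
    by (rule measurable_compose[OF sel_meas]) simp
  have U: "?U \<in> borel_measurable M"
    by (rule measurable_compose[OF sel_measurable]) simp
  have V_past: "?V \<in> borel_measurable (past k)"
    by (intro gap_sq_measurable[OF assms] state_measurable_past order.refl)
  have indep: "indep_set (sets ?sel) (sets (past k))"
    unfolding past_def by (rule sel_indep_past)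
  have sub: "sigma_sets (space M) {f -` A \<inter> space M | A. A \<in> sets borel} \<subseteq> sets F"
    if "f \<in> borel_measurable F" "space F = space M" for f :: "'w \<Rightarrow> real" and F
    unfolding that(2)[symmetric] using measurable_sets[OF that(1)]
    by (intro sets.sigma_sets_subset) auto
  have "indep_set (sigma_sets (space M) {?U -` A \<inter> space M | A. A \<in> sets borel})
     (sigma_sets (space M) {?V -` A \<inter> space M | A. A \<in> sets borel})"
    unfolding indep_set_def
    by (rule indep_sets_mono_sets[OF indep[unfolded indep_set_def]])
      (use sub[OF U_sel] sub[OF V_past] in \<open>auto split: bool.splits\<close>)
  then have iv: "indep_var borel ?U borel ?V"
    using U gap_sq_integrable[OF assms] by (simp add: indep_var_eq)
  have intU: "integrable M ?U"
    using U by (intro integrable_const_bound[where B=1] AE_I2) (auto simp: indicator_def)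
  have EU: "expectation ?U = 1 / card (peer_pairs N)"
  proof -
    have "expectation ?U = expectation (indicator (sel k -` {q} \<inter> space M))"
      by (intro Bochner_Integration.integral_cong) (auto simp: indicator_def)
    then show ?thesis
      using prob_sel[OF assms] by simp
  qed
  show "integrable M (\<lambda>\<omega>. ?U \<omega> * ?V \<omega>)"
    by (rule indep_var_integrable[OF iv intU gap_sq_integrable[OF assms]])
  show "expectation (\<lambda>\<omega>. ?U \<omega> * ?V \<omega>) = expectation ?V / card (peer_pairs N)"
    using indep_var_lebesgue_integral[OF iv intU gap_sq_integrable[OF assms]] EU by simp
qed

text \<open>
  Each summand is at most the energy loss of that step divided by \<open>2 w (1 - w)\<close>; the losses
  telescope, and the energy never exceeds \<open>N\<close> because the states stay in the unit interval.
\<close>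

lemma selected_gaps_bounded:
  assumes "\<omega> \<in> space M"
  shows "(\<Sum>k<n. indicator {q} (sel k \<omega>) * gap_sq \<Delta> q (X k \<omega>)) \<le> N / (2 * w * (1 - w))"
proof -
  have drop: "indicator {q} (sel k \<omega>) * gap_sq \<Delta> q (X k \<omega>)
      \<le> (energy N (X k \<omega>) - energy N (X (Suc k) \<omega>)) / (2 * w * (1 - w))" for k
  proof -
    have "energy N (X (Suc k) \<omega>) = energy N (interact \<Delta> w (sel k \<omega>) (X k \<omega>))"
      unfolding energy_def using step[OF _ assms] by (intro sum.cong) auto
    then have "energy N (X k \<omega>) - energy N (X (Suc k) \<omega>)
        = 2 * w * (1 - w) * gap_sq \<Delta> (sel k \<omega>) (X k \<omega>)"
      using energy_interact[OF sel_in_pairs[OF assms]] by simp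
    then show ?thesis
      using w gap_sq_nonneg by (auto simp: indicator_def)
  qed
  have "(\<Sum>k<n. indicator {q} (sel k \<omega>) * gap_sq \<Delta> q (X k \<omega>))
      \<le> (\<Sum>k<n. (energy N (X k \<omega>) - energy N (X (Suc k) \<omega>)) / (2 * w * (1 - w)))"
    by (intro sum_mono drop)
  also have "\<dots> = (energy N (X 0 \<omega>) - energy N (X n \<omega>)) / (2 * w * (1 - w))"
    unfolding sum_divide_distrib[symmetric]
    using sum_lessThan_telescope'[of "\<lambda>k. energy N (X k \<omega>)" n] by simp
  also have "\<dots> \<le> N / (2 * w * (1 - w))"
  proof (rule divide_right_mono)
    have "energy N (X 0 \<omega>) \<le> (\<Sum>i\<in>{1..N}. 1)"
      unfolding energy_def using initial_range[OF _ assms]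
      by (intro sum_mono) (auto simp: power_le_one)
    moreover have "energy N (X n \<omega>) \<ge> 0"
      unfolding energy_def by (intro sum_nonneg) auto
    ultimately show "energy N (X 0 \<omega>) - energy N (X n \<omega>) \<le> N" by simp
  qed (use w in simp)
  finally show ?thesis .
qed

lemma expected_gaps_bounded:
  assumes "q \<in> peer_pairs N"
  shows "(\<Sum>k<n. expectation (\<lambda>\<omega>. gap_sq \<Delta> q (X k \<omega>)))
    \<le> card (peer_pairs N) * (N / (2 * w * (1 - w)))"
proof -
  have pos: "card (peer_pairs N) > 0"
    using assms finite_peer_pairs by (auto simp: card_gt_0_iff)
  have "(\<Sum>k<n. expectation (\<lambda>\<omega>. gap_sq \<Delta> q (X k \<omega>))) / card (peer_pairs N)
      = expectation (\<lambda>\<omega>. \<Sum>k<n. indicator {q} (sel k \<omega>) * gap_sq \<Delta> q (X k \<omega>))"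
    by (subst Bochner_Integration.integral_sum)
      (simp_all only: expectation_selected_gap[OF assms] sum_divide_distrib)
  also have "\<dots> \<le> N / (2 * w * (1 - w))"
    using expectation_selected_gap[OF assms] selected_gaps_bounded
    by (intro integral_le_const Bochner_Integration.integrable_sum AE_I2) auto
  finally show ?thesis
    using pos by (simp add: field_simps)
qed

text \<open>
  By monotone convergence the random series of truncated squared distances has finite expectation.
  It is then almost surely convergent, and its terms tend to zero.
\<close>

lemma AE_gaps_vanish:
  "AE \<omega> in M. \<forall>q\<in>peer_pairs N. (\<lambda>k. gap_sq \<Delta> q (X k \<omega>)) \<longlonglongrightarrow> 0"
proof (rule AE_finite_allI[OF finite_peer_pairs])
  fix q assume q: "q \<in> peer_pairs N"
  let ?B = "card (peer_pairs N) * (N / (2 * w * (1 - w)))"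
  note meas = gap_sq_measurable[OF q state_measurable]
  have meas'[measurable]: "(\<lambda>\<omega>. ennreal (gap_sq \<Delta> q (X k \<omega>))) \<in> borel_measurable M" for k
    using meas by simp
  have "(\<integral>\<^sup>+\<omega>. (\<Sum>k. ennreal (gap_sq \<Delta> q (X k \<omega>))) \<partial>M) = (\<Sum>k. \<integral>\<^sup>+\<omega>. ennreal (gap_sq \<Delta> q (X k \<omega>)) \<partial>M)"
    using meas' by (rule nn_integral_suminf)
  also have "\<dots> = (\<Sum>k. ennreal (expectation (\<lambda>\<omega>. gap_sq \<Delta> q (X k \<omega>))))"
    using nn_integral_eq_integral[OF gap_sq_integrable[OF q]] gap_sq_nonneg by simp
  also have "\<dots> \<le> ennreal ?B"
  proof (rule suminf_le_const[OF summableI])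
    fix n
    have "(\<Sum>k<n. ennreal (expectation (\<lambda>\<omega>. gap_sq \<Delta> q (X k \<omega>))))
        = ennreal (\<Sum>k<n. expectation (\<lambda>\<omega>. gap_sq \<Delta> q (X k \<omega>)))"
      by (intro sum_ennreal Bochner_Integration.integral_nonneg gap_sq_nonneg)
    then show "(\<Sum>k<n. ennreal (expectation (\<lambda>\<omega>. gap_sq \<Delta> q (X k \<omega>)))) \<le> ennreal ?B"
      using expected_gaps_bounded[OF q, of n] by (simp only: ennreal_leI)
  qed
  finally have "(\<integral>\<^sup>+\<omega>. (\<Sum>k. ennreal (gap_sq \<Delta> q (X k \<omega>))) \<partial>M) \<noteq> \<infinity>"
    by (auto simp: top_unique)
  then have "AE \<omega> in M. (\<Sum>k. ennreal (gap_sq \<Delta> q (X k \<omega>))) \<noteq> \<infinity>"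
    by (intro nn_integral_PInf_AE) measurable
  then show "AE \<omega> in M. (\<lambda>k. gap_sq \<Delta> q (X k \<omega>)) \<longlonglongrightarrow> 0"
  proof eventually_elim
    case (elim \<omega>)
    then show ?case
      by (intro summable_LIMSEQ_zero summable_suminf_not_top gap_sq_nonneg) simp
  qed
qed

lemma AE_confidence_path: "AE \<omega> in M. confidence_path N \<Delta> w (\<lambda>k. sel k \<omega>) (\<lambda>k. X k \<omega>)"
  using AE_gaps_vanish AE_space
proof eventually_elim
  case (elim \<omega>)
  show ?case
  proof
    show "X (Suc k) \<omega> i = interact \<Delta> w (sel k \<omega>) (X k \<omega>) i" if "i \<in> {1..N}" for k i
      using that elim(2) by (rule step)
    show "(\<lambda>k. gap_sq \<Delta> q (X k \<omega>)) \<longlonglongrightarrow> 0" if "q \<in> peer_pairs N" for q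
      using elim(1) that by blast
  qed (fact \<Delta>(1) w sel_in_pairs[OF elim(2)])+
qed

section \<open>The limit and the freezing time\<close>

text \<open>
  Freezing is observed on the connectedness of the pairs and not on the clusters: this is stronger,
  still happens almost surely, and is visibly a countable combination of measurable events.
\<close>

definition frozen_from :: "nat \<Rightarrow> 'w \<Rightarrow> bool" where
  "frozen_from n \<omega> \<longleftrightarrow> (\<forall>k\<in>{n..}. \<forall>i\<in>{1..N}. \<forall>j\<in>{1..N}.
     (\<bar>X k \<omega> i - X k \<omega> j\<bar> \<le> \<Delta>) = (\<bar>X n \<omega> i - X n \<omega> j\<bar> \<le> \<Delta>))"

lemma frozen_from_measurable: "Measurable.pred M (frozen_from n)"
proof -
  have "Measurable.pred M (\<lambda>\<omega>. (\<bar>X k \<omega> i - X k \<omega> j\<bar> \<le> \<Delta>) = (\<bar>X n \<omega> i - X n \<omega> j\<bar> \<le> \<Delta>))"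
    if "i \<in> {1..N}" "j \<in> {1..N}" for k i j
  proof -
    note [measurable] = state_measurable[OF that(1)] state_measurable[OF that(2)]
    show ?thesis by measurable
  qed
  then show ?thesis
    unfolding frozen_from_def[abs_def]
    by (intro pred_intros_countable_bounded countable_finite) auto
qed

lemma frozen_from_iff:
  "frozen_from n \<omega> \<longleftrightarrow> (\<forall>k\<ge>n. connected_peers N \<Delta> (X k \<omega>) = connected_peers N \<Delta> (X n \<omega>))"
proof -
  have "connected_peers N \<Delta> x = connected_peers N \<Delta> y \<longleftrightarrow>
      (\<forall>i\<in>{1..N}. \<forall>j\<in>{1..N}. (\<bar>x i - x j\<bar> \<le> \<Delta>) = (\<bar>y i - y j\<bar> \<le> \<Delta>))" for x y
    unfolding connected_peers_def set_eq_iff split_paired_All mem_Collect_eq prod.case by blast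
  then show ?thesis
    by (simp only: frozen_from_def atLeast_iff Ball_def)
qed

definition freezing_time :: "'w \<Rightarrow> enat" where
  "freezing_time \<omega> = (if \<exists>n. frozen_from n \<omega> then enat (LEAST n. frozen_from n \<omega>) else \<infinity>)"

lemma cluster_freezing_time_exists: "cluster_freezing_time M N \<Delta> X freezing_time"
  unfolding cluster_freezing_time_def
proof
  note [measurable] = frozen_from_measurable
  show "freezing_time \<in> M \<rightarrow>\<^sub>M count_space UNIV"
    unfolding freezing_time_def[abs_def] by measurable
  show "AE \<omega> in M. freezing_time \<omega> < \<infinity> \<and> (\<forall>k. freezing_time \<omega> \<le> enat k \<longrightarrow>
      clusters N \<Delta> (X k \<omega>) = clusters N \<Delta> (X (the_enat (freezing_time \<omega>)) \<omega>))"
    using AE_confidence_path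
  proof eventually_elim
    case (elim \<omega>)
    interpret confidence_path N \<Delta> w "\<lambda>k. sel k \<omega>" "\<lambda>k. X k \<omega>" by (rule elim)
    have ex: "frozen_from settling_time \<omega>"
      by (simp add: frozen_from_iff connected_peers_settled)
    define n where "n = (LEAST n. frozen_from n \<omega>)"
    have "frozen_from n \<omega>"
      unfolding n_def using ex by (rule LeastI)
    then have frozen: "clusters N \<Delta> (X k \<omega>) = clusters N \<Delta> (X n \<omega>)" if "n \<le> k" for k
      using that unfolding frozen_from_iff clusters_def by metis
    have time: "freezing_time \<omega> = enat n"
      unfolding freezing_time_def n_def by (rule if_P) (use ex in blast)
    show ?case
      unfolding time enat_ord_simps the_enat.simps using frozen by blast
  qed
qed

text \<open>
  Truncation to the unit interval has no effect where the trajectory converges. On the exceptional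
  null set it keeps the values of \<open>lim\<close> in range, so that the occupancy measure of the profile is a
  probability measure on the unit interval for every outcome.
\<close>

definition limit_profile :: "'w \<Rightarrow> nat \<Rightarrow> real" where
  "limit_profile \<omega> i = max 0 (min 1 (lim (\<lambda>k. X k \<omega> i)))"

lemma limit_profile_eq:
  assumes "i \<in> {1..N}" "\<omega> \<in> space M" "(\<lambda>k. X k \<omega> i) \<longlonglongrightarrow> l"
  shows "limit_profile \<omega> i = l"
proof -
  have "l \<in> {0..1}"
    by (rule closed_sequentially[OF closed_atLeastAtMost _ assms(3)]) (use state_range assms in blast)
  then show ?thesis
    using limI[OF assms(3)] by (simp add: limit_profile_def)
qed

lemma limit_profile_range: "limit_profile \<omega> i \<in> {0..1}"
  by (auto simp: limit_profile_def)

lemma limit_profile_measurable: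
  assumes "i \<in> {1..N}"
  shows "(\<lambda>\<omega>. limit_profile \<omega> i) \<in> borel_measurable M"
proof -
  note [measurable] = state_measurable[OF assms]
  show ?thesis
    unfolding limit_profile_def by measurable
qed

lemma AE_occupancy_converges:
  "AE \<omega> in M. limitin weak_topology01 (\<lambda>k. occupancy N (X k \<omega>)) (occupancy N (limit_profile \<omega>)) sequentially"
  using AE_confidence_path AE_space
proof eventually_elim
  case (elim \<omega>)
  interpret confidence_path N \<Delta> w "\<lambda>k. sel k \<omega>" "\<lambda>k. X k \<omega>" by (rule elim)
  have "(\<lambda>k. X k \<omega> i) \<longlonglongrightarrow> limit_profile \<omega> i" if "i \<in> {1..N}" for i
    using converges[OF that] limit_profile_eq[OF that elim(2) converges[OF that]] by simp
  then show ?case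
    using N state_range[OF _ elim(2)] by (intro limitin_occupancy) auto
qed

text \<open>
  A freezing time may come before or after the settling time of the trajectory. The clusters at the
  later of the two coincide with those at either, which identifies the cluster count with the number
  of classes of the final relation.
\<close>

lemma AE_partial_consensus:
  assumes "cluster_freezing_time M N \<Delta> X K"
  shows "AE \<omega> in M. partial_consensus \<Delta> (final_cluster_count N \<Delta> X K \<omega>) (occupancy N (limit_profile \<omega>))"
proof -
  have "AE \<omega> in M. K \<omega> < \<infinity> \<and> (\<forall>k. K \<omega> \<le> enat k \<longrightarrow>
      clusters N \<Delta> (X k \<omega>) = clusters N \<Delta> (X (the_enat (K \<omega>)) \<omega>))"
    using assms by (simp add: cluster_freezing_time_def)
  then show ?thesis
    using AE_confidence_path AE_space
  proof eventually_elim
    case (elim \<omega>)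
    interpret confidence_path N \<Delta> w "\<lambda>k. sel k \<omega>" "\<lambda>k. X k \<omega>" by (rule elim)
    obtain n where n: "K \<omega> = enat n"
      using elim(1) by auto
    have "K \<omega> \<le> enat (max n settling_time)"
      using n by simp
    then have "clusters N \<Delta> (X (max n settling_time) \<omega>) = clusters N \<Delta> (X (the_enat (K \<omega>)) \<omega>)"
      using elim(1) by blast
    moreover have "clusters N \<Delta> (X (max n settling_time) \<omega>) = {1..N} // final_rel"
      by (rule clusters_settled) simp
    ultimately have count: "final_cluster_count N \<Delta> X K \<omega> = card ({1..N} // final_rel)"
      by (simp only: final_cluster_count_def)
    have L: "limit_profile \<omega> i = limit_state i" if "i \<in> {1..N}" for i
      using limit_profile_eq[OF that elim(3) converges[OF that]] .
    show ?case
      unfolding count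
    proof (rule partial_consensus_occupancy[OF _ _ equiv_final_rel])
      fix i j assume "(i, j) \<in> final_rel"
      then show "limit_profile \<omega> i = limit_profile \<omega> j"
        using L limit_state_same_class equiv_type[OF equiv_final_rel] by auto
    next
      fix i j assume "i \<in> {1..N}" "j \<in> {1..N}" "(i, j) \<notin> final_rel"
      then show "\<bar>limit_profile \<omega> i - limit_profile \<omega> j\<bar> > \<Delta>"
        using L limit_state_separated by simp
    qed (use N limit_profile_range in auto)
  qed
qed

end

theorem theorem3p1:
  fixes M :: "'w measure" and N :: nat and \<Delta> w :: real
    and sel :: "nat \<Rightarrow> 'w \<Rightarrow> nat \<times> nat"
    and X :: "nat \<Rightarrow> 'w \<Rightarrow> nat \<Rightarrow> real"
  assumes "bounded_confidence M N \<Delta> w sel X"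
  shows "(\<exists>K. cluster_freezing_time M N \<Delta> X K) \<and>
    (\<exists>Mlim \<in> M \<rightarrow>\<^sub>M prob_algebra borel01.
       (AE \<omega> in M. limitin weak_topology01 (\<lambda>k. occupancy N (X k \<omega>)) (Mlim \<omega>) sequentially) \<and>
       (\<forall>K. cluster_freezing_time M N \<Delta> X K \<longrightarrow>
          (AE \<omega> in M. partial_consensus \<Delta> (final_cluster_count N \<Delta> X K \<omega>) (Mlim \<omega>))))"
proof -
  interpret bounded_confidence M N \<Delta> w sel X by (rule assms)
  have "(\<lambda>\<omega>. occupancy N (limit_profile \<omega>)) \<in> M \<rightarrow>\<^sub>M prob_algebra borel01"
    using N limit_profile_measurable limit_profile_range by (intro measurable_occupancy) auto
  then show ?thesis
    using cluster_freezing_time_exists AE_occupancy_converges AE_partial_consensus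
    by (intro conjI bexI[where x="\<lambda>\<omega>. occupancy N (limit_profile \<omega>)"] exI allI impI)
qed

end
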